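(* Let $G=\mathbb{Z}_2\times\mathbb{Z}_2\times\mathbb{Z}_2\times\mathbb{Z}_2$, let $S$ be a proper subset of $G\setminus\{0\}$ that generates $G$, and let $S_0=S\cup\{0\}$. Let $0\in C\subseteq G$. Then $C$ is a perfect code in $\mathrm{Cay}(G,S)$ if and only if there exist four elements $\mathbf{e}_1,\mathbf{e}_2,\mathbf{e}_3,\mathbf{e}_4$ generating $G$ and integer parameters such that $(S_0,C)$ is one of the following pairs: (1) $S_0=\{k\mathbf{e}_1+\alpha_{ij}\mathbf{e}_2+i\mathbf{e}_3+j\mathbf{e}_4\mid i,j,k\in[2]\}$, $C=\{\lambda_i\mathbf{e}_1+i\mathbf{e}_2\mid i\in[2]\}$; (2) $S_0=\{\alpha_{ijk}\mathbf{e}_1+i\mathbf{e}_2+j\mathbf{e}_3+k\mathbf{e}_4\mid i,j,k\in[2]\}$, $C=\{i\mathbf{e}_1\mid i\in[2]\}$.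
   Context: Groups are finite abelian, written additively; $\mathbb{Z}_n$ is the group of integers modulo $n$ and $[n]=\{0,1,\dots,n-1\}$. For $S\subseteq G\setminus\{0\}$, $\mathrm{Cay}(G,S)$ is the directed graph with vertex set $G$ and an arc from $x$ to $y$ if and only if $y-x\in S$ ($S$ is not assumed to be inverse-closed). A subset $C\subseteq G$ is a perfect code in $\mathrm{Cay}(G,S)$ if the sets $\{c\}\cup\{v:\text{there is an arc from } c \text{ to } v\}$, $c\in C$, form a partition of $G$. Greek letters with subscripts denote arbitrary integers, one for each value of the displayed indices, subject only to $\lambda_0=\alpha_{00}=\alpha_{000}=0$. *)

theory Defs
  imports
    "HOL-Algebra.Elementary_Groups"
    "HOL-Algebra.Generated_Groups"
    "HOL-Library.Disjoint_Sets"
    "Graph_Theory.Pair_Digraph"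
begin

text \<open>
  The Cayley digraph; in additive notation there is an arc from \<open>x\<close> to \<open>y\<close> iff
  \<open>y - x\<close> lies in the connection set, which need not be closed under inverses.
\<close>

definition cayley_digraph :: "('a, 'b) monoid_scheme \<Rightarrow> 'a set \<Rightarrow> 'a pair_pre_digraph" where
  "cayley_digraph G S =
    \<lparr> pverts = carrier G,
      parcs = {(x, y). x \<in> carrier G \<and> y \<in> carrier G \<and> y \<otimes>\<^bsub>G\<^esub> inv\<^bsub>G\<^esub> x \<in> S} \<rparr>"

definition closed_out_nbhd :: "('a, 'b) pre_digraph \<Rightarrow> 'a \<Rightarrow> 'a set" where
  "closed_out_nbhd D c = insert c {v. c \<rightarrow>\<^bsub>D\<^esub> v}"

text \<open>
  The closed out-neighbourhoods form a partition as a family indexed by \<open>C\<close>: two different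
  elements of \<open>C\<close> may not have the same closed out-neighbourhood.  Using \<open>partition_on\<close> with
  the set of these neighbourhoods would lose this requirement.  The members are nonempty
  because \<open>c\<close> belongs to its own closed out-neighbourhood.
\<close>

definition perfect_code :: "('a, 'b) pre_digraph \<Rightarrow> 'a set \<Rightarrow> bool" where
  "perfect_code D C \<longleftrightarrow>
    C \<subseteq> verts D \<and>
    disjoint_family_on (closed_out_nbhd D) C \<and>
    (\<Union>c\<in>C. closed_out_nbhd D c) = verts D"

end

theory Submission
  imports Defs
begin

text \<open>
  The closed out-neighbourhood of \<open>c\<close> in the Cayley digraph is the translate of
  \<open>S0 = S \<union> {\<one>}\<close> by \<open>c\<close>.  Hence \<open>C\<close> is a perfect code exactly when \<open>G\<close> is tiled by these
  translates, that is, when \<open>(c, s) \<mapsto> c \<otimes> s\<close> is a bijection from \<open>C \<times> S0\<close> onto \<open>G\<close>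
  (\<open>perfect_code_iff_bij_betw\<close>).

  If there is such a tiling, \<open>card S0\<close> divides 16.  In a group of exponent two, \<open>n\<close> elements
  generate at most \<open>2 ^ n\<close> elements, so a generating set \<open>S\<close> has at least four elements and
  \<open>S0\<close> at least five; it has fewer than 16 because \<open>S\<close> is a proper subset of the nonidentity
  elements.  So \<open>card S0 = 8\<close> and \<open>card C = 2\<close> (\<open>card_code_eq_2\<close>).  Thus \<open>C = {\<one>, a}\<close> is
  automatically a subgroup, and \<open>S0\<close> is a transversal of its cosets.  Extending \<open>a\<close> to a basis
  and recording, for each coset, which of its two elements is in \<open>S0\<close> gives the second normal
  form (\<open>transversal_normal_form\<close>).

  Conversely, in both normal forms \<open>C\<close> has at most 2 and \<open>S0\<close> at most 8 elements.  Solving for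
  the exponents modulo 2 shows that each of the 16 group elements is a product \<open>c \<otimes> s\<close>, and
  by counting it is so in only one way (\<open>bij_betw_mult_if_covers\<close>).
\<close>

section \<open>Perfect codes as tilings\<close>

lemma (in comm_group) closed_out_nbhd_cayley_digraph:
  assumes S: "S \<subseteq> carrier G" and c: "c \<in> carrier G"
  shows "closed_out_nbhd (with_proj (cayley_digraph G S)) c = (\<lambda>s. c \<otimes> s) ` (S \<union> {\<one>})"
proof -
  have "{v. c \<rightarrow>\<^bsub>with_proj (cayley_digraph G S)\<^esub> v} = {v \<in> carrier G. v \<otimes> inv c \<in> S}"
    using c by (auto simp: cayley_digraph_def)
  also have "\<dots> = (\<lambda>s. c \<otimes> s) ` S"
  proof (intro equalityI subsetI)
    fix v assume "v \<in> {v \<in> carrier G. v \<otimes> inv c \<in> S}"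
    moreover from this have "v = c \<otimes> (v \<otimes> inv c)"
      using c m_lcomm[of c v "inv c"] by simp
    ultimately show "v \<in> (\<lambda>s. c \<otimes> s) ` S" by blast
  next
    fix v assume "v \<in> (\<lambda>s. c \<otimes> s) ` S"
    then obtain s where s: "s \<in> S" "v = c \<otimes> s" by blast
    then have "v \<otimes> inv c = s"
      using c S m_comm[of c s] by (auto simp: m_assoc)
    then show "v \<in> {v \<in> carrier G. v \<otimes> inv c \<in> S}"
      using s c S by auto
  qed
  finally show ?thesis
    using c by (auto simp: closed_out_nbhd_def)
qed

lemma (in comm_group) perfect_code_iff_bij_betw:
  assumes S: "S \<subseteq> carrier G" and C: "C \<subseteq> carrier G"
  shows "perfect_code (with_proj (cayley_digraph G S)) C \<longleftrightarrow>
    bij_betw (\<lambda>(c, s). c \<otimes> s) (C \<times> (S \<union> {\<one>})) (carrier G)"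
proof -
  let ?T = "S \<union> {\<one>}"
  have N: "closed_out_nbhd (with_proj (cayley_digraph G S)) c = (\<lambda>s. c \<otimes> s) ` ?T" if "c \<in> C" for c
    using closed_out_nbhd_cayley_digraph S C that by blast
  have V: "verts (with_proj (cayley_digraph G S)) = carrier G"
    by (simp add: cayley_digraph_def)
  have U: "(\<Union>c\<in>C. (\<lambda>s. c \<otimes> s) ` ?T) = (\<lambda>(c, s). c \<otimes> s) ` (C \<times> ?T)"
    by force
  have "disjoint_family_on (closed_out_nbhd (with_proj (cayley_digraph G S))) C \<longleftrightarrow>
      disjoint_family_on (\<lambda>c. (\<lambda>s. c \<otimes> s) ` ?T) C"
    unfolding disjoint_family_on_def using N by simp
  also have "\<dots> \<longleftrightarrow> inj_on (\<lambda>(c, s). c \<otimes> s) (C \<times> ?T)"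
  proof
    assume D: "disjoint_family_on (\<lambda>c. (\<lambda>s. c \<otimes> s) ` ?T) C"
    show "inj_on (\<lambda>(c, s). c \<otimes> s) (C \<times> ?T)"
    proof (rule inj_onI, clarify)
      fix c s d t
      assume *: "c \<in> C" "s \<in> ?T" "d \<in> C" "t \<in> ?T" "c \<otimes> s = d \<otimes> t"
      then have "c = d"
        using D unfolding disjoint_family_on_def by blast
      moreover have "c \<in> carrier G" "s \<in> carrier G" "t \<in> carrier G"
        using * S C by auto
      ultimately show "c = d \<and> s = t"
        using * by simp
    qed
  next
    assume inj: "inj_on (\<lambda>(c, s). c \<otimes> s) (C \<times> ?T)"
    have "c = d" if "c \<in> C" "s \<in> ?T" "d \<in> C" "t \<in> ?T" "c \<otimes> s = d \<otimes> t" for c s d t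
    proof -
      have "(c, s) = (d, t)"
        by (rule inj_onD[OF inj]) (use that in simp_all)
      then show ?thesis by simp
    qed
    then show "disjoint_family_on (\<lambda>c. (\<lambda>s. c \<otimes> s) ` ?T) C"
      unfolding disjoint_family_on_def by blast
  qed
  finally show ?thesis
    unfolding perfect_code_def bij_betw_def V using N U C by simp
qed

text \<open>
  A covering family of translates whose sizes add up to at most the order of the group cannot
  overlap.  Thus uniqueness of the factorisation never has to be checked by hand.
\<close>

lemma (in monoid) bij_betw_mult_if_covers:
  assumes card: "card (carrier G) = m * n"
    and C: "C \<subseteq> carrier G" "finite C" "card C \<le> m"
    and T: "T \<subseteq> carrier G" "finite T" "card T \<le> n"
    and cover: "\<And>g. g \<in> carrier G \<Longrightarrow> \<exists>c\<in>C. \<exists>s\<in>T. g = c \<otimes> s"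
  shows "bij_betw (\<lambda>(c, s). c \<otimes> s) (C \<times> T) (carrier G)"
proof -
  have im: "(\<lambda>(c, s). c \<otimes> s) ` (C \<times> T) = carrier G"
    using C T cover by force
  have fin: "finite (C \<times> T)" using C T by simp
  have "card C * card T \<le> m * n" using C T by (intro mult_le_mono)
  moreover have "card (carrier G) \<le> card (C \<times> T)"
    unfolding im[symmetric] using fin by (rule card_image_le)
  ultimately have "card ((\<lambda>(c, s). c \<otimes> s) ` (C \<times> T)) = card (C \<times> T)"
    unfolding im using card by (simp add: card_cartesian_product)
  then show ?thesis
    unfolding bij_betw_def using im eq_card_imp_inj_on[OF fin] by blast
qed

section \<open>Groups of exponent two\<close>

locale boolean_group = comm_group +
  assumes square_eq_one: "x \<in> carrier G \<Longrightarrow> x \<otimes> x = \<one>"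
begin

lemma cancel_left_square:
  assumes "x \<in> carrier G" "y \<in> carrier G"
  shows "x \<otimes> (x \<otimes> y) = y"
  using assms square_eq_one by (simp flip: m_assoc)

lemma inv_eq_self: "x \<in> carrier G \<Longrightarrow> inv x = x"
  using square_eq_one inv_equality by blast

lemma int_pow_eq_nat_pow:
  fixes n :: int
  assumes "x \<in> carrier G"
  obtains k :: nat where "k < 2" "x [^] n = x [^] k"
proof
  show "nat (n mod 2) < 2" by (simp add: nat_less_iff)
  have "x [^] n = x [^] (2 * (n div 2) + n mod 2)" by simp
  also have "\<dots> = (x [^] (2 :: int)) [^] (n div 2) \<otimes> x [^] (n mod 2)"
    using assms by (simp only: int_pow_mult int_pow_pow)
  also have "x [^] (2 :: int) = \<one>"
    using assms square_eq_one int_pow_mult[of x 1 1] by simp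
  also have "x [^] (n mod 2) = x [^] nat (n mod 2)"
    using int_pow_int[of G x "nat (n mod 2)"] by simp
  finally show "x [^] n = x [^] nat (n mod 2)"
    using assms by simp
qed

text \<open>
  Because \<open>a\<close> is its own inverse and commutes with everything, the subgroup generated by \<open>H\<close>
  together with its translate by \<open>a\<close> is already closed.  The elements are indexed by an
  exponent below 2, which is what makes iteration yield coordinates and cardinality bounds.
\<close>

lemma generate_insert:
  assumes H: "H \<subseteq> carrier G" and a: "a \<in> carrier G"
  shows "generate G (insert a H) = (\<lambda>(i, h). a [^] i \<otimes> h) ` ({..<2::nat} \<times> generate G H)"
    (is "_ = ?R")
proof
  let ?K = "generate G H"
  have Ksub: "subgroup ?K G" using H by (rule generate_is_subgroup)
  have KC: "?K \<subseteq> carrier G" using H by (rule generate_incl)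
  have R: "?R = ?K \<union> (\<lambda>h. a \<otimes> h) ` ?K" (is "_ = ?U")
  proof -
    have "?R = (\<Union>i\<in>{..<2::nat}. (\<lambda>h. a [^] i \<otimes> h) ` ?K)" by auto
    also have "\<dots> = (\<Union>i\<in>{0, 1::nat}. (\<lambda>h. a [^] i \<otimes> h) ` ?K)"
      by (intro SUP_cong) auto
    also have "\<dots> = (\<lambda>h. \<one> \<otimes> h) ` ?K \<union> (\<lambda>h. a \<otimes> h) ` ?K"
      using a by simp
    also have "(\<lambda>h. \<one> \<otimes> h) ` ?K = ?K"
      using KC by force
    finally show ?thesis .
  qed
  show "?R \<subseteq> generate G (insert a H)"
  proof -
    have "?K \<subseteq> generate G (insert a H)" by (intro mono_generate) auto
    moreover have "a \<in> generate G (insert a H)" by (simp add: generate.incl)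
    ultimately show ?thesis
      unfolding R by (auto intro: generate.eng)
  qed
  have "subgroup ?U G"
  proof
    show "?U \<subseteq> carrier G" using KC a by auto
    show "\<one> \<in> ?U" by (simp add: generate.one)
    show "inv x \<in> ?U" if "x \<in> ?U" for x
      using that KC a by (metis (no_types, lifting) Un_iff image_iff inv_eq_self m_closed subsetD)
    show "x \<otimes> y \<in> ?U" if xy: "x \<in> ?U" "y \<in> ?U" for x y
    proof -
      note [intro] = subgroup.m_closed[OF Ksub]
      consider "x \<in> ?K" "y \<in> ?K" | h where "h \<in> ?K" "x = a \<otimes> h" "y \<in> ?K"
        | h where "h \<in> ?K" "y = a \<otimes> h" "x \<in> ?K"
        | h k where "h \<in> ?K" "k \<in> ?K" "x = a \<otimes> h" "y = a \<otimes> k"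
        using xy by blast
      then show ?thesis
      proof cases
        case 1 then show ?thesis by auto
      next
        case (2 h)
        then have "x \<otimes> y = a \<otimes> (h \<otimes> y)" using a KC by (simp add: m_assoc subset_iff)
        then show ?thesis using 2 by auto
      next
        case (3 h)
        then have "x \<otimes> y = a \<otimes> (x \<otimes> h)" using a KC by (simp add: m_lcomm subset_iff)
        then show ?thesis using 3 by auto
      next
        case (4 h k)
        then have "h \<in> carrier G" "k \<in> carrier G" using KC by auto
        then have "x \<otimes> y = h \<otimes> k"
          using 4 a by (simp add: m_assoc m_lcomm[of h] cancel_left_square)
        then show ?thesis using 4 by auto
      qed
    qed
  qed
  moreover have "insert a H \<subseteq> ?U"
    using a generate.one[of G H] by (force intro: generate.incl)
  ultimately show "generate G (insert a H) \<subseteq> ?R"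
    unfolding R by (rule generate_subgroup_incl[rotated])
qed

lemma finite_generate_card_le:
  assumes "finite H" "H \<subseteq> carrier G"
  shows "finite (generate G H) \<and> card (generate G H) \<le> 2 ^ card H"
  using assms
proof (induction H)
  case empty
  then show ?case by (simp add: generate_empty)
next
  case (insert a H)
  let ?A = "{..<2::nat} \<times> generate G H"
  have gen: "generate G (insert a H) = (\<lambda>(i, h). a [^] i \<otimes> h) ` ?A"
    using insert.prems by (intro generate_insert) auto
  have A: "finite ?A" "card ?A \<le> 2 * 2 ^ card H"
    using insert by (auto simp: card_cartesian_product)
  have "card (generate G (insert a H)) \<le> card ?A"
    unfolding gen using A(1) by (rule card_image_le)
  with A insert.hyps show ?case
    unfolding gen by auto
qed

lemma card_generate_insert:
  assumes H: "H \<subseteq> carrier G" and a: "a \<in> carrier G" and notin: "a \<notin> generate G H"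
  shows "card (generate G (insert a H)) = 2 * card (generate G H)"
proof -
  let ?K = "generate G H"
  have Ksub: "subgroup ?K G" using H by (rule generate_is_subgroup)
  have K: "h \<in> carrier G" if "h \<in> ?K" for h using that generate_incl[OF H] by auto
  \<comment> \<open>If \<open>h = a \<otimes> k\<close> with \<open>h\<close> and \<open>k\<close> in the subgroup, then \<open>a = h \<otimes> k\<close> is in it too.\<close>
  have ne: "a \<otimes> k \<noteq> h" if "h \<in> ?K" "k \<in> ?K" for h k
  proof
    assume "a \<otimes> k = h"
    then have "h \<otimes> k = a \<otimes> (k \<otimes> k)" using that a K by (auto simp: m_assoc)
    also have "\<dots> = a" using that a K by (simp add: square_eq_one)
    finally show False using notin subgroup.m_closed[OF Ksub that] by simp
  qed
  have "inj_on (\<lambda>(i, h). a [^] i \<otimes> h) ({..<2::nat} \<times> ?K)"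
  proof (rule inj_onI, clarify)
    fix i j :: nat and h k
    assume "i < 2" "j < 2" "h \<in> ?K" "k \<in> ?K" "a [^] i \<otimes> h = a [^] j \<otimes> k"
    then show "i = j \<and> h = k"
      using a K ne[of h k] ne[of k h] by (auto simp: less_2_cases_iff)
  qed
  then show ?thesis
    by (simp add: generate_insert[OF H a] card_image card_cartesian_product)
qed

lemma generate_four:
  assumes "a \<in> carrier G" "b \<in> carrier G" "c \<in> carrier G" "d \<in> carrier G"
    and "x \<in> generate G {a, b, c, d}"
  obtains i j k l :: nat where "i < 2" "j < 2" "k < 2" "l < 2"
    "x = a [^] i \<otimes> b [^] j \<otimes> c [^] k \<otimes> d [^] l"
proof -
  have "x \<in> (\<lambda>(i, h). a [^] i \<otimes> h) ` ({..<2::nat} \<times>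
      (\<lambda>(i, h). b [^] i \<otimes> h) ` ({..<2::nat} \<times>
      (\<lambda>(i, h). c [^] i \<otimes> h) ` ({..<2::nat} \<times>
      (\<lambda>(i, h). d [^] i \<otimes> h) ` ({..<2::nat} \<times> {\<one>}))))"
    using assms by (simp add: generate_insert generate_empty)
  then obtain i j k l :: nat where "i < 2" "j < 2" "k < 2" "l < 2"
    "x = a [^] i \<otimes> (b [^] j \<otimes> (c [^] k \<otimes> (d [^] l \<otimes> \<one>)))"
    by auto
  with assms show thesis
    by (intro that) (auto simp: m_assoc)
qed

text \<open>
  Basis extension by counting: an element outside the subgroup generated so far doubles its order,
  so three further choices lead from order 2 to order 16.
\<close>

lemma card_eq_16_obtain_generators:
  assumes card: "card (carrier G) = 16" and a: "a \<in> carrier G" "a \<noteq> \<one>"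
  obtains b c d where "b \<in> carrier G" "c \<in> carrier G" "d \<in> carrier G"
    "generate G {a, b, c, d} = carrier G"
proof -
  have fin: "finite (carrier G)" using card by (simp add: card_ge_0_finite)
  have ex: "\<exists>x \<in> carrier G. x \<notin> generate G H"
    if "H \<subseteq> carrier G" "card (generate G H) < 16" for H
  proof (rule ccontr)
    assume "\<not> ?thesis"
    then have "generate G H = carrier G" using generate_incl[OF that(1)] by blast
    then show False using that(2) card by simp
  qed
  have 1: "card (generate G {a}) = 2"
    using card_generate_insert[of "{}" a] a by (simp add: generate_empty)
  obtain b where b: "b \<in> carrier G" "b \<notin> generate G {a}" using ex[of "{a}"] 1 a by auto
  have 2: "card (generate G {b, a}) = 4" using card_generate_insert[of "{a}" b] 1 a b by simp
  obtain c where c: "c \<in> carrier G" "c \<notin> generate G {b, a}" using ex[of "{b, a}"] 2 a b by auto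
  have 3: "card (generate G {c, b, a}) = 8"
    using card_generate_insert[of "{b, a}" c] 2 a b c by simp
  obtain d where d: "d \<in> carrier G" "d \<notin> generate G {c, b, a}"
    using ex[of "{c, b, a}"] 3 a b c by auto
  have "card (generate G {d, c, b, a}) = 16"
    using card_generate_insert[of "{c, b, a}" d] 3 a b c d by simp
  moreover have "generate G {d, c, b, a} \<subseteq> carrier G"
    using a b c d by (intro generate_incl) auto
  ultimately have "generate G {d, c, b, a} = carrier G"
    using card fin by (simp add: card_subset_eq)
  moreover have "{d, c, b, a} = {a, b, c, d}" by auto
  ultimately show thesis using that a b c d by metis
qed

section \<open>Tilings of the group of order sixteen\<close>

text \<open>
  With \<open>card C * card S0 = 16\<close> it suffices to confine \<open>card S0\<close> to the range from 5 to 15: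
  generation gives the lower bound, properness of the inclusion the upper one.
\<close>

lemma card_code_eq_2:
  assumes card: "card (carrier G) = 16"
    and S: "S \<subset> carrier G - {\<one>}" and gen: "generate G S = carrier G"
    and bij: "bij_betw (\<lambda>(c, s). c \<otimes> s) (C \<times> (S \<union> {\<one>})) (carrier G)"
  shows "card C = 2"
proof -
  have fin: "finite (carrier G)" using card by (simp add: card_ge_0_finite)
  then have finS: "finite S" using S by (meson finite_Diff finite_subset psubset_imp_subset)
  have "\<one> \<notin> S" using S by auto
  then have cS: "card (S \<union> {\<one>}) = Suc (card S)" using finS by simp
  have prod: "card C * Suc (card S) = 16"
    using bij_betw_same_card[OF bij] card cS by (simp add: card_cartesian_product)
  \<comment> \<open>\<open>S\<close> generates all 16 elements, but at most \<open>2 ^ card S\<close>.\<close>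
  have "(2::nat) ^ 4 \<le> 2 ^ card S"
    using finite_generate_card_le[OF finS] S gen card by auto
  then have lower: "4 \<le> card S"
    by (subst (asm) power_increasing_iff) auto
  have "card S < card (carrier G - {\<one>})"
    using fin S by (intro psubset_card_mono) auto
  then have upper: "card S < 15" using card fin by simp
  have "card C \<noteq> 0" using prod by (intro notI) simp
  moreover have "card C \<noteq> 1" using prod upper by (intro notI) simp
  moreover have "card C < 4"
  proof (rule ccontr)
    assume "\<not> card C < 4"
    then have "4 * 5 \<le> card C * Suc (card S)" using lower by (intro mult_le_mono) auto
    then show False using prod by simp
  qed
  moreover have "card C \<noteq> 3"
  proof
    assume "card C = 3"
    with prod have "3 * Suc (card S) = 16" by simp
    then show False by presburger
  qed
  ultimately show ?thesis by linarith
qed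

text \<open>
  A tiling by \<open>{\<one>, a}\<close> means that each coset \<open>{x, a \<otimes> x}\<close> meets \<open>T\<close> in exactly one
  element.  The cosets are represented by the products of \<open>b\<close>, \<open>c\<close> and \<open>d\<close>; the exponent
  \<open>\<alpha> i j k\<close> tells whether \<open>T\<close> contains the representative itself or its translate by \<open>a\<close>.
\<close>

lemma transversal_normal_form:
  assumes bij: "bij_betw (\<lambda>(c, s). c \<otimes> s) ({\<one>, a} \<times> T) (carrier G)"
    and T: "T \<subseteq> carrier G" "\<one> \<in> T"
    and e: "a \<in> carrier G" "b \<in> carrier G" "c \<in> carrier G" "d \<in> carrier G" "a \<noteq> \<one>"
    and gen: "generate G {a, b, c, d} = carrier G"
  shows "\<exists>\<alpha> :: nat \<Rightarrow> nat \<Rightarrow> nat \<Rightarrow> int. \<alpha> 0 0 0 = 0 \<and>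
    T = {a [^] \<alpha> i j k \<otimes> b [^] i \<otimes> c [^] j \<otimes> d [^] k | i j k.
      i \<in> {..<2} \<and> j \<in> {..<2} \<and> k \<in> {..<2}}"
proof -
  define h where "h i j k = b [^] i \<otimes> c [^] j \<otimes> d [^] k" for i j k :: nat
  define \<alpha> :: "nat \<Rightarrow> nat \<Rightarrow> nat \<Rightarrow> int" where "\<alpha> i j k = (if h i j k \<in> T then 0 else 1)" for i j k
  have h: "h i j k \<in> carrier G" for i j k using e by (simp add: h_def)
  have not_both: "a \<otimes> x \<notin> T" if "x \<in> T" for x
  proof
    assume ax: "a \<otimes> x \<in> T"
    have "(\<one>, a \<otimes> x) = (a, x)"
      using bij that ax e T by (intro inj_onD[OF bij_betw_imp_inj_on[OF bij]]) auto
    then show False using e by simp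
  qed
  have one_of: "x \<in> T \<or> a \<otimes> x \<in> T" if x: "x \<in> carrier G" for x
  proof -
    obtain y t where "y \<in> {\<one>, a}" "t \<in> T" "x = y \<otimes> t"
      using x bij unfolding bij_betw_def by force
    then show ?thesis using T e by (auto simp: cancel_left_square subset_iff)
  qed
  have assoc: "a [^] \<alpha> i j k \<otimes> b [^] i \<otimes> c [^] j \<otimes> d [^] k = a [^] \<alpha> i j k \<otimes> h i j k" for i j k
    using e by (simp add: h_def m_assoc)
  have val: "a [^] \<alpha> i j k \<otimes> h i j k = (if h i j k \<in> T then h i j k else a \<otimes> h i j k)" for i j k
    using e h by (simp add: \<alpha>_def)
  have "T = {a [^] \<alpha> i j k \<otimes> h i j k | i j k. i \<in> {..<2} \<and> j \<in> {..<2} \<and> k \<in> {..<2}}"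
    (is "_ = ?R")
  proof
    have "a [^] \<alpha> i j k \<otimes> h i j k \<in> T" for i j k
      unfolding val using one_of[OF h, of i j k] by auto
    then show "?R \<subseteq> T" by blast
    show "T \<subseteq> ?R"
    proof
      fix t assume t: "t \<in> T"
      then obtain m i j k :: nat where m: "m < 2" "i < 2" "j < 2" "k < 2"
        "t = a [^] m \<otimes> b [^] i \<otimes> c [^] j \<otimes> d [^] k"
        using generate_four[of a b c d t] e gen T by blast
      then have "t = a [^] m \<otimes> h i j k" using e by (simp add: h_def m_assoc)
      then have "t = a [^] \<alpha> i j k \<otimes> h i j k"
        unfolding val using t m(1) not_both[of "h i j k"] e h by (auto simp: less_2_cases_iff)
      then show "t \<in> ?R" using m by blast
    qed
  qed
  moreover have "\<alpha> 0 0 0 = 0" using T e by (simp add: \<alpha>_def h_def)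
  ultimately show ?thesis unfolding assoc[symmetric] by blast
qed

lemma bij_betw_form_two:
  fixes \<alpha> :: "nat \<Rightarrow> nat \<Rightarrow> nat \<Rightarrow> int"
  assumes card: "card (carrier G) = 16"
    and gen: "generate G {a, b, c, d} = carrier G"
    and T: "T = {a [^] \<alpha> i j k \<otimes> b [^] i \<otimes> c [^] j \<otimes> d [^] k | i j k.
      i \<in> {..<2} \<and> j \<in> {..<2} \<and> k \<in> {..<2}}"
    and C: "C = {a [^] i | i. i \<in> {..<2::nat}}"
    and e: "a \<in> carrier G" "b \<in> carrier G" "c \<in> carrier G" "d \<in> carrier G"
  shows "bij_betw (\<lambda>(c, s). c \<otimes> s) (C \<times> T) (carrier G)"
proof (rule bij_betw_mult_if_covers[where m = 2 and n = 8])
  show "card (carrier G) = 2 * 8" using card by simp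
next
  have C': "C = (\<lambda>i. a [^] i) ` {..<2::nat}" using C by auto
  then show "finite C" by simp
  show "card C \<le> 2" unfolding C' using card_image_le[of "{..<2::nat}"]
    by (metis card_lessThan finite_lessThan)
  show "C \<subseteq> carrier G" unfolding C using e by auto
  have T': "T = (\<lambda>(i, j, k). a [^] \<alpha> i j k \<otimes> b [^] i \<otimes> c [^] j \<otimes> d [^] k) ` ({..<2} \<times> {..<2} \<times> {..<2})"
    unfolding T by force
  then show "finite T" by simp
  have "card T \<le> card ({..<2::nat} \<times> {..<2::nat} \<times> {..<2::nat})"
    unfolding T' by (rule card_image_le) simp
  then show "card T \<le> 8" by (simp add: card_cartesian_product)
  show "T \<subseteq> carrier G" unfolding T using e by auto
next
  fix g assume "g \<in> carrier G"
  then obtain m i j k :: nat where m: "m < 2" "i < 2" "j < 2" "k < 2"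
    "g = a [^] m \<otimes> b [^] i \<otimes> c [^] j \<otimes> d [^] k"
    using generate_four[of a b c d g] e gen by blast
  let ?s = "a [^] \<alpha> i j k \<otimes> b [^] i \<otimes> c [^] j \<otimes> d [^] k"
  \<comment> \<open>The factor from \<open>C\<close> corrects the exponent of \<open>a\<close> from \<open>\<alpha> i j k\<close> to \<open>m\<close>.\<close>
  obtain t :: nat where t: "t < 2" "a [^] (int m - \<alpha> i j k) = a [^] t"
    using int_pow_eq_nat_pow e by blast
  have "a [^] m = a [^] (int m - \<alpha> i j k) \<otimes> a [^] \<alpha> i j k"
    using e by (simp flip: int_pow_mult add: int_pow_int)
  then have "g = a [^] t \<otimes> ?s"
    using m e t by (simp add: m_assoc)
  moreover have "?s \<in> T" unfolding T using m by blast
  moreover have "a [^] t \<in> C" unfolding C using t by blast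
  ultimately show "\<exists>c\<in>C. \<exists>s\<in>T. g = c \<otimes> s" by blast
qed

lemma bij_betw_form_one:
  fixes \<alpha> :: "nat \<Rightarrow> nat \<Rightarrow> int" and l :: "nat \<Rightarrow> int"
  assumes card: "card (carrier G) = 16"
    and gen: "generate G {a, b, c, d} = carrier G"
    and T: "T = {a [^] k \<otimes> b [^] \<alpha> i j \<otimes> c [^] i \<otimes> d [^] j | i j k.
      i \<in> {..<2} \<and> j \<in> {..<2} \<and> k \<in> {..<2::nat}}"
    and C: "C = {a [^] l i \<otimes> b [^] i | i. i \<in> {..<2}}"
    and e: "a \<in> carrier G" "b \<in> carrier G" "c \<in> carrier G" "d \<in> carrier G"
  shows "bij_betw (\<lambda>(c, s). c \<otimes> s) (C \<times> T) (carrier G)"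
proof (rule bij_betw_mult_if_covers[where m = 2 and n = 8])
  show "card (carrier G) = 2 * 8" using card by simp
next
  have C': "C = (\<lambda>i. a [^] l i \<otimes> b [^] i) ` {..<2::nat}" using C by auto
  then show "finite C" by simp
  show "card C \<le> 2" unfolding C' using card_image_le[of "{..<2::nat}"]
    by (metis card_lessThan finite_lessThan)
  show "C \<subseteq> carrier G" unfolding C using e by auto
  have T': "T = (\<lambda>(i, j, k). a [^] k \<otimes> b [^] \<alpha> i j \<otimes> c [^] i \<otimes> d [^] j) ` ({..<2} \<times> {..<2} \<times> {..<2::nat})"
    unfolding T by force
  then show "finite T" by simp
  have "card T \<le> card ({..<2::nat} \<times> {..<2::nat} \<times> {..<2::nat})"
    unfolding T' by (rule card_image_le) simp
  then show "card T \<le> 8" by (simp add: card_cartesian_product)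
  show "T \<subseteq> carrier G" unfolding T using e by auto
next
  fix g assume "g \<in> carrier G"
  then obtain m n i j :: nat where m: "m < 2" "n < 2" "i < 2" "j < 2"
    "g = a [^] m \<otimes> b [^] n \<otimes> c [^] i \<otimes> d [^] j"
    using generate_four[of a b c d g] e gen by blast
  \<comment> \<open>The exponent of \<open>b\<close> decides which element of \<open>C\<close> to take; that element contributes
    \<open>l t\<close> to the exponent of \<open>a\<close>, and the free exponent \<open>k\<close> in \<open>T\<close> supplies the rest.\<close>
  obtain t :: nat where t: "t < 2" "b [^] (int n - \<alpha> i j) = b [^] t"
    using int_pow_eq_nat_pow e by blast
  obtain k :: nat where k: "k < 2" "a [^] (int m - l t) = a [^] k"
    using int_pow_eq_nat_pow e by blast
  let ?s = "a [^] k \<otimes> b [^] \<alpha> i j \<otimes> c [^] i \<otimes> d [^] j"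
  have b: "b [^] n = b [^] (int n - \<alpha> i j) \<otimes> b [^] \<alpha> i j"
    using e by (simp flip: int_pow_mult add: int_pow_int)
  have a: "a [^] m = a [^] l t \<otimes> a [^] (int m - l t)"
    using e by (simp flip: int_pow_mult add: int_pow_int)
  have "g = a [^] l t \<otimes> a [^] k \<otimes> (b [^] t \<otimes> b [^] \<alpha> i j) \<otimes> c [^] i \<otimes> d [^] j"
    using m(5) a b k t by simp
  also have "\<dots> = (a [^] l t \<otimes> b [^] t) \<otimes> ?s"
    using e by (simp add: m_ac)
  finally have "g = (a [^] l t \<otimes> b [^] t) \<otimes> ?s" .
  moreover have "?s \<in> T" unfolding T using m k by blast
  moreover have "a [^] l t \<otimes> b [^] t \<in> C" unfolding C using t by blast
  ultimately show "\<exists>c\<in>C. \<exists>s\<in>T. g = c \<otimes> s" by blast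
qed

end

theorem theorem5p9:
  fixes G :: "(int \<times> int \<times> int \<times> int) monoid" (structure)
    and S S0 C :: "(int \<times> int \<times> int \<times> int) set"
  assumes "G = integer_mod_group 2 \<times>\<times> integer_mod_group 2 \<times>\<times> integer_mod_group 2 \<times>\<times> integer_mod_group 2"
    and "S \<subset> carrier G - {\<one>}"
    and "generate G S = carrier G"
    and "S0 = S \<union> {\<one>}"
    and "\<one> \<in> C"
    and "C \<subseteq> carrier G"
  shows "perfect_code (with_proj (cayley_digraph G S)) C \<longleftrightarrow>
    (\<exists>e1\<in>carrier G. \<exists>e2\<in>carrier G. \<exists>e3\<in>carrier G. \<exists>e4\<in>carrier G.
      generate G {e1, e2, e3, e4} = carrier G \<and>
      ((\<exists>(\<alpha> :: nat \<Rightarrow> nat \<Rightarrow> int) (l :: nat \<Rightarrow> int).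
          \<alpha> 0 0 = 0 \<and> l 0 = 0 \<and>
          S0 = {e1 [^] k \<otimes> e2 [^] \<alpha> i j \<otimes> e3 [^] i \<otimes> e4 [^] j | i j k.
                  i \<in> {..<2} \<and> j \<in> {..<2} \<and> k \<in> {..<2::nat}} \<and>
          C = {e1 [^] l i \<otimes> e2 [^] i | i. i \<in> {..<2}}) \<or>
       (\<exists>\<alpha> :: nat \<Rightarrow> nat \<Rightarrow> nat \<Rightarrow> int.
          \<alpha> 0 0 0 = 0 \<and>
          S0 = {e1 [^] \<alpha> i j k \<otimes> e2 [^] i \<otimes> e3 [^] j \<otimes> e4 [^] k | i j k.
                  i \<in> {..<2} \<and> j \<in> {..<2} \<and> k \<in> {..<2}} \<and>
          C = {e1 [^] i | i. i \<in> {..<2::nat}})))"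
    (is "?P \<longleftrightarrow> ?Q")
proof -
  have grp: "Group.group G"
    unfolding assms(1) by (intro DirProd_group group_integer_mod_group)
  have carr: "carrier G = {0..<2} \<times> {0..<2} \<times> {0..<2} \<times> {0..<2}"
    unfolding assms(1) by (simp add: DirProd_def carrier_integer_mod_group)
  have mult: "(x1, x2, x3, x4) \<otimes> (y1, y2, y3, y4) =
      ((x1 + y1) mod 2, (x2 + y2) mod 2, (x3 + y3) mod 2, (x4 + y4) mod 2)" for x1 x2 x3 x4 y1 y2 y3 y4
    unfolding assms(1) by (simp add: DirProd_def mult_integer_mod_group)
  have one: "\<one> = (0, 0, 0, 0)"
    unfolding assms(1) by (simp add: DirProd_def)
  interpret Group.group G by (fact grp)
  have comm: "comm_group G"
    by (rule group_comm_groupI) (auto simp: mult carr add.commute)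
  interpret comm_group G by (fact comm)
  interpret boolean_group G
    by unfold_locales (auto simp: carr mult one)
  have card: "card (carrier G) = 16"
    by (simp add: carr card_cartesian_product)
  have S0: "S0 \<subseteq> carrier G" "\<one> \<in> S0" using assms by auto
  have code: "?P \<longleftrightarrow> bij_betw (\<lambda>(c, s). c \<otimes> s) (C \<times> S0) (carrier G)"
    unfolding assms(4) using assms by (intro perfect_code_iff_bij_betw) auto
  show ?thesis
  proof
    assume ?P
    with code have bij: "bij_betw (\<lambda>(c, s). c \<otimes> s) (C \<times> S0) (carrier G)" by blast
    then have "card C = 2"
      using card_code_eq_2[OF card assms(2,3)] assms(4) by blast
    then obtain a where a: "C = {\<one>, a}" "a \<noteq> \<one>"
      using assms(5) by (auto simp: card_2_iff doubleton_eq_iff)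
    then have ac: "a \<in> carrier G" using assms(6) by auto
    obtain b c d where e: "b \<in> carrier G" "c \<in> carrier G" "d \<in> carrier G"
      and gen: "generate G {a, b, c, d} = carrier G"
      using card_eq_16_obtain_generators[OF card ac a(2)] by blast
    have "{a [^] i | i. i \<in> {..<2::nat}} = (\<lambda>i. a [^] i) ` {..<2::nat}" by blast
    also have "\<dots> = (\<lambda>i. a [^] i) ` {0, 1::nat}" by (intro image_cong) auto
    also have "\<dots> = C" using a(1) ac by simp
    finally have "C = {a [^] i | i. i \<in> {..<2::nat}}" by (rule sym)
    moreover note transversal_normal_form[OF bij[unfolded a(1)] S0 ac e a(2) gen]
    ultimately show ?Q using ac e gen by blast
  next
    assume ?Q
    then show ?P
      unfolding code
      by (elim bexE conjE disjE exE)
        (rule bij_betw_form_one[OF card], assumption+, rule bij_betw_form_two[OF card], assumption+)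
  qed
qed

end
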